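(* Let $G$ be a finite simple graph. Then $\operatorname{reg}(I(G)^{[2]})\leq 2+\nu(G)$ (with the convention $\operatorname{reg}((0))=1$).
   Context: $G$ is a finite simple graph on vertex set $\{x_1,\ldots,x_n\}$ identified with the variables of $S=K[x_1,\ldots,x_n]$ ($K$ a field); edges are identified with degree-2 monomials. $I(G)$ is the edge ideal of $G$, and $I(G)^{[2]}$ is the ideal generated by all products $e_1e_2$ of two disjoint edges of $G$ (the second squarefree power). $\nu(G)$ is the matching number of $G$. For a graded ideal $I\neq0$, $\operatorname{reg}(I)=\max\{j-i: \dim_K\operatorname{Tor}_i^S(I,K)_j\neq0\}$; by convention $\operatorname{reg}((0))=1$. *)

theory Defs
  imports Main "HOL-Library.Poly_Mapping"
begin

text \<open>Polynomial ring S = K[x_v : v in 'v] over a field K ('k), for a finite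
  (linearly ordered) vertex type 'v. Monomials are 'v =>0 nat (exponent vectors).\<close>

type_synonym ('v, 'k) mpoly = "('v \<Rightarrow>\<^sub>0 nat) \<Rightarrow>\<^sub>0 'k"

definition var :: "'v \<Rightarrow> ('v, 'k::comm_ring_1) mpoly" where
  "var v = Poly_Mapping.single (Poly_Mapping.single v 1) 1"

definition mdeg :: "('v::finite \<Rightarrow>\<^sub>0 nat) \<Rightarrow> nat" where
  "mdeg m = (\<Sum>v\<in>UNIV. Poly_Mapping.lookup m v)"

text \<open>Homogeneous of (integer) degree d; the zero polynomial is homogeneous of every degree.\<close>
definition homogeneous :: "int \<Rightarrow> ('v::finite, 'k::comm_ring_1) mpoly \<Rightarrow> bool" where
  "homogeneous d p \<longleftrightarrow> (\<forall>m\<in>Poly_Mapping.keys p. int (mdeg m) = d)"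

definition gen_ideal :: "('v, 'k::comm_ring_1) mpoly set \<Rightarrow> ('v, 'k) mpoly set" where
  "gen_ideal A = {\<Sum>a\<in>T. r a * a | T r. finite T \<and> T \<subseteq> A}"

text \<open>Simple graph on vertex set UNIV :: 'v set, edges are 2-element sets.\<close>
definition simple_graph :: "'v set set \<Rightarrow> bool" where
  "simple_graph E \<longleftrightarrow> (\<forall>e\<in>E. card e = 2)"

definition edge_mon :: "'v set \<Rightarrow> ('v, 'k::comm_ring_1) mpoly" where
  "edge_mon e = (\<Prod>v\<in>e. var v)"

definition edge_ideal :: "'v set set \<Rightarrow> ('v, 'k::comm_ring_1) mpoly set" where
  "edge_ideal E = gen_ideal (edge_mon ` E)"

definition sqfree_power2 :: "'v set set \<Rightarrow> ('v, 'k::comm_ring_1) mpoly set" where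
  "sqfree_power2 E = gen_ideal {edge_mon e1 * edge_mon e2 | e1 e2. e1 \<in> E \<and> e2 \<in> E \<and> e1 \<inter> e2 = {}}"

definition matching :: "'v set set \<Rightarrow> 'v set set \<Rightarrow> bool" where
  "matching E M \<longleftrightarrow> M \<subseteq> E \<and> (\<forall>e1\<in>M. \<forall>e2\<in>M. e1 \<noteq> e2 \<longrightarrow> e1 \<inter> e2 = {})"

definition matching_number :: "'v set set \<Rightarrow> nat" where
  "matching_number E = Max (card ` {M. matching E M})"

text \<open>Tor via the Koszul resolution K(x) of K = S/(x_v) (a free resolution of K, so
  Tor_i^S(I,K) = H_i(I \<otimes>_S K(x))). The module I \<otimes>_S K(x)_i is identified with
  I^(binomial n i): a chain is a function c from subsets F of the vertex set to I,
  supported on |F| = i (basis element e_F of degree |F|).  The differential is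
  d(f e_F) = \<Sum>_{k\<in>F} (-1)^{#{l\<in>F. l<k}} x_k f e_{F-{k}}.\<close>

definition koszul_sign :: "'v::linorder \<Rightarrow> 'v set \<Rightarrow> 'k::comm_ring_1" where
  "koszul_sign k F = (-1) ^ card {l\<in>F. l < k}"

definition koszul_d :: "('v::{finite,linorder} set \<Rightarrow> ('v, 'k::comm_ring_1) mpoly)
                         \<Rightarrow> ('v set \<Rightarrow> ('v, 'k) mpoly)" where
  "koszul_d c = (\<lambda>G. \<Sum>k\<in>UNIV - G.
      Poly_Mapping.single 0 (koszul_sign k (insert k G)) * var k * c (insert k G))"

text \<open>Degree-j part of I \<otimes>_S K(x)_i: coefficient of e_F lies in I and is homogeneous
  of degree j - i.\<close>
definition koszul_chains :: "('v::{finite,linorder}, 'k::comm_ring_1) mpoly set \<Rightarrow> nat \<Rightarrow> int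
                              \<Rightarrow> ('v set \<Rightarrow> ('v, 'k) mpoly) set" where
  "koszul_chains I i j = {c. \<forall>F. (card F \<noteq> i \<longrightarrow> c F = 0)
                                \<and> c F \<in> I \<and> homogeneous (j - int i) (c F)}"

text \<open>Tor_i^S(I,K)_j \<noteq> 0, i.e. the homology (cycles modulo boundaries) in homological
  degree i and internal degree j is a nonzero K-vector space.\<close>
definition tor_nonzero :: "('v::{finite,linorder}, 'k::field) mpoly set \<Rightarrow> nat \<Rightarrow> int \<Rightarrow> bool" where
  "tor_nonzero I i j \<longleftrightarrow>
     \<not> ({c \<in> koszul_chains I i j. koszul_d c = (\<lambda>_. 0)}
         \<subseteq> koszul_d ` koszul_chains I (Suc i) j)"

definition reg :: "('v::{finite,linorder}, 'k::field) mpoly set \<Rightarrow> int" where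
  "reg I = (if I = {0} then 1
            else Max {j - int i | i j. tor_nonzero I i j})"

end

theory Submission
  imports Defs "HOL.Modules" "HOL-Library.Function_Algebras" "HOL-Library.Set_Algebras"
begin

text \<open>
  For a squarefree monomial ideal \<open>I\<close> and a variable \<open>x\<close>, let \<open>J\<close> be generated by the monomials of
  \<open>I\<close> that do not involve \<open>x\<close>. The Mayer--Vietoris sequence of \<open>I = J + x(I : x)\<close>, where
  \<open>J \<inter> x(I : x) = xJ\<close>, gives \<open>reg I \<le> max (reg J) (reg (I : x) + 1)\<close>.

  Applied to \<open>I(G)\<close> this yields \<open>reg I(G) \<le> \<nu>(G) + 1\<close>, because an edge at \<open>x\<close> extends every
  matching of \<open>G - N(x)\<close>, where \<open>x\<close> is isolated. For \<open>I(G)\<^sup>[\<^sup>2\<^sup>]\<close> split at \<open>x\<close> and then at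
  the neighbours \<open>y\<close> of \<open>x\<close> one after the other. What remains is \<open>I(G - N(x))\<^sup>[\<^sup>2\<^sup>]\<close>, where \<open>\<nu>\<close>
  has dropped, and the colon ideals by \<open>x y\<close>. Such a colon ideal is the edge ideal of
  \<open>G - x - y\<close> together with all \<open>a b\<close> with \<open>a \<in> N(x) - {y}\<close>, \<open>b \<in> N(y) - {x}\<close>, \<open>a \<noteq> b\<close>. Its
  regularity is at most \<open>\<nu>(G)\<close>: splitting at such an \<open>a\<close>, the edges that are left in the colon
  ideal by \<open>a\<close> avoid \<open>x\<close>, \<open>a\<close>, \<open>y\<close> and \<open>b\<close>, so each matching of them extends by both
  \<open>x a\<close> and \<open>y b\<close>.
\<close>

section \<open>Squarefree monomial ideals\<close>

interpretation ideal: module "(*) :: 'a::comm_ring_1 \<Rightarrow> 'a \<Rightarrow> 'a"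
  by standard (simp_all add: algebra_simps)

(* as a rewrite rule this is mult.assoc reversed, which loops with ac_simps *)
declare ideal.scale_scale [simp del]

lemma gen_ideal_eq_span: "gen_ideal A = ideal.span A"
  by (simp add: gen_ideal_def ideal.span_explicit)

lemma poly_mapping_sum_monomials:
  "(\<Sum>m\<in>Poly_Mapping.keys p. Poly_Mapping.single m (Poly_Mapping.lookup p m)) = p"
  by (rule poly_mapping_eqI) (auto simp: lookup_sum lookup_single when_def in_keys_iff)

lemma keys_monomial_add:
  fixes m n :: "'v \<Rightarrow>\<^sub>0 nat"
  shows "Poly_Mapping.keys (m + n) = Poly_Mapping.keys m \<union> Poly_Mapping.keys n"
  by (auto simp: in_keys_iff lookup_add)

definition sqfree_mon :: "'v::finite set \<Rightarrow> ('v \<Rightarrow>\<^sub>0 nat)" where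
  "sqfree_mon F = (\<Sum>v\<in>F. Poly_Mapping.single v 1)"

lemma lookup_sqfree_mon: "Poly_Mapping.lookup (sqfree_mon F) v = (if v \<in> F then 1 else 0)"
  by (simp add: sqfree_mon_def lookup_sum lookup_single when_def)

lemma keys_sqfree_mon [simp]: "Poly_Mapping.keys (sqfree_mon F) = F"
  by (auto simp: in_keys_iff lookup_sqfree_mon split: if_splits)

lemma subset_keys_iff_sqfree_mon_add:
  "F \<subseteq> Poly_Mapping.keys m \<longleftrightarrow> (\<exists>n. m = sqfree_mon F + n)"
proof
  assume "F \<subseteq> Poly_Mapping.keys m"
  then have "m = sqfree_mon F + (m - sqfree_mon F)"
    by (intro poly_mapping_eqI) (auto simp: lookup_add lookup_minus lookup_sqfree_mon in_keys_iff)
  then show "\<exists>n. m = sqfree_mon F + n" ..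
qed (auto simp: keys_monomial_add)

lemma in_keys_iff_sqfree_mon_add:
  "x \<in> Poly_Mapping.keys m \<longleftrightarrow> (\<exists>n. m = sqfree_mon {x} + n)"
  by (simp flip: subset_keys_iff_sqfree_mon_add)

lemma var_eq_single: "var x = Poly_Mapping.single (sqfree_mon {x}) 1"
  by (simp add: var_def sqfree_mon_def)

lemma edge_mon_eq_single: "edge_mon F = Poly_Mapping.single (sqfree_mon F) 1"
proof -
  have "finite F" by simp
  then show ?thesis
    unfolding edge_mon_def sqfree_mon_def
    by (induction F rule: finite_induct) (simp_all add: var_def mult_single)
qed

lemma edge_mon_Un:
  fixes F G :: "'v::finite set"
  shows "F \<inter> G = {} \<Longrightarrow> edge_mon (F \<union> G) = edge_mon F * edge_mon G"
  unfolding edge_mon_def by (rule prod.union_disjoint) auto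

text \<open>From here on \<^const>\<open>edge_ideal\<close> is applied to arbitrary families of vertex sets, as a notation for
  squarefree monomial ideals.\<close>

lemma edge_ideal_eq_span: "edge_ideal \<F> = ideal.span (edge_mon ` \<F>)"
  by (simp add: edge_ideal_def gen_ideal_eq_span)

lemma subspace_keys_superset:
  "ideal.subspace {p :: ('v, 'k::comm_ring_1) mpoly.
    \<forall>m\<in>Poly_Mapping.keys p. \<exists>F\<in>\<F>. F \<subseteq> Poly_Mapping.keys m}" (is "ideal.subspace ?I")
proof (rule ideal.subspaceI)
  show "p + q \<in> ?I" if "p \<in> ?I" "q \<in> ?I" for p q
    using that keys_add[of p q] by auto
  show "p * q \<in> ?I" if q: "q \<in> ?I" for p q
  proof (intro CollectI ballI)
    fix m assume "m \<in> Poly_Mapping.keys (p * q)"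
    then obtain n n' where "m = n + n'" "n' \<in> Poly_Mapping.keys q"
      using keys_mult[of p q] by blast
    moreover from this obtain F where "F \<in> \<F>" "F \<subseteq> Poly_Mapping.keys n'"
      using q by auto
    ultimately show "\<exists>F\<in>\<F>. F \<subseteq> Poly_Mapping.keys m"
      by (auto simp: keys_monomial_add)
  qed
qed simp

lemma single_in_edge_ideal:
  fixes \<F> :: "'v::finite set set"
  assumes "F \<in> \<F>" "F \<subseteq> Poly_Mapping.keys m"
  shows "Poly_Mapping.single m a \<in> edge_ideal \<F>"
proof -
  obtain n where m: "m = sqfree_mon F + n"
    using assms(2) by (auto simp: subset_keys_iff_sqfree_mon_add)
  have "Poly_Mapping.single m a = Poly_Mapping.single n a * edge_mon F"
    by (simp add: m edge_mon_eq_single mult_single add.commute)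
  then show ?thesis
    using assms(1) by (simp add: edge_ideal_eq_span ideal.span_base ideal.span_scale)
qed

lemma mem_edge_ideal_iff:
  fixes p :: "('v::finite, 'k::comm_ring_1) mpoly"
  shows "p \<in> edge_ideal \<F> \<longleftrightarrow> (\<forall>m\<in>Poly_Mapping.keys p. \<exists>F\<in>\<F>. F \<subseteq> Poly_Mapping.keys m)"
    (is "_ \<longleftrightarrow> ?superset p")
proof
  have "edge_mon ` \<F> \<subseteq> {p :: ('v, 'k) mpoly. ?superset p}"
    unfolding edge_mon_eq_single by (simp add: image_subset_iff) blast
  then have "ideal.span (edge_mon ` \<F>) \<subseteq> {p :: ('v, 'k) mpoly. ?superset p}"
    by (rule ideal.span_minimal[OF _ subspace_keys_superset])
  then show "?superset p" if "p \<in> edge_ideal \<F>"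
    using that by (auto simp: edge_ideal_eq_span)
next
  assume "?superset p"
  then have "Poly_Mapping.single m (Poly_Mapping.lookup p m) \<in> edge_ideal \<F>"
    if "m \<in> Poly_Mapping.keys p" for m
    using that single_in_edge_ideal by blast
  then have "(\<Sum>m\<in>Poly_Mapping.keys p. Poly_Mapping.single m (Poly_Mapping.lookup p m))
      \<in> edge_ideal \<F>"
    unfolding edge_ideal_eq_span by (rule ideal.span_sum)
  then show "p \<in> edge_ideal \<F>"
    by (simp only: poly_mapping_sum_monomials)
qed

lemma edge_ideal_eqI:
  fixes \<F> \<G> :: "'v::finite set set"
  assumes "\<And>F. F \<in> \<F> \<Longrightarrow> \<exists>G\<in>\<G>. G \<subseteq> F" "\<And>G. G \<in> \<G> \<Longrightarrow> \<exists>F\<in>\<F>. F \<subseteq> G"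
  shows "edge_ideal \<F> = edge_ideal \<G>"
proof -
  have "(\<exists>F\<in>\<F>. F \<subseteq> S) \<longleftrightarrow> (\<exists>G\<in>\<G>. G \<subseteq> S)" for S
    using assms by (meson order_trans)
  then show ?thesis
    by (simp add: set_eq_iff mem_edge_ideal_iff)
qed

lemma edge_ideal_Un: "edge_ideal (\<F> \<union> \<G>) = edge_ideal \<F> + edge_ideal \<G>"
  by (auto simp: edge_ideal_eq_span image_Un ideal.span_Un set_plus_def)

lemma edge_ideal_insert_image:
  assumes "x \<notin> \<Union>\<F>"
  shows "edge_ideal (insert x ` \<F>) =
    (*) (var x) ` (edge_ideal \<F> :: ('v::finite, 'k::comm_ring_1) mpoly set)"
proof -
  have "edge_mon (insert x F) = (var x * edge_mon F :: ('v, 'k) mpoly)" if "F \<in> \<F>" for F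
    using that assms edge_mon_Un[of "{x}" F] by (auto simp: edge_mon_def)
  then have "edge_mon ` insert x ` \<F> = (*) (var x) ` (edge_mon ` \<F> :: ('v, 'k) mpoly set)"
    by (simp add: image_image)
  moreover have "module_hom (*) (*) ((*) (var x :: ('v, 'k) mpoly))"
    by (rule ideal.module_hom_scale_self)
  ultimately show ?thesis
    by (simp add: edge_ideal_eq_span module_hom.span_image)
qed

lemma edge_ideal_empty [simp]: "edge_ideal {} = {0}"
  by (simp add: edge_ideal_eq_span)

lemma edge_ideal_eq_UNIV:
  "{} \<in> \<F> \<Longrightarrow> edge_ideal \<F> = (UNIV :: ('v::finite, 'k::comm_ring_1) mpoly set)"
  by (auto simp: mem_edge_ideal_iff)

section \<open>Graded ideals\<close>

lemma mdeg_add: "mdeg (m + n) = mdeg m + mdeg n"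
  by (simp add: mdeg_def lookup_add sum.distrib)

lemma mdeg_sqfree_mon: "mdeg (sqfree_mon F) = card F"
  by (simp add: mdeg_def lookup_sqfree_mon sum.If_cases)

lemma homogeneous_0 [simp]: "homogeneous d 0"
  by (simp add: homogeneous_def)

lemma homogeneous_var: "homogeneous 1 (var x)"
  by (simp add: homogeneous_def var_eq_single mdeg_sqfree_mon)

lemma homogeneous_uminus: "homogeneous d p \<Longrightarrow> homogeneous d (- p)"
  by (simp add: homogeneous_def)

lemma homogeneous_add: "homogeneous d p \<Longrightarrow> homogeneous d q \<Longrightarrow> homogeneous d (p + q)"
  using keys_add[of p q] by (auto simp: homogeneous_def)

lemma homogeneous_diff: "homogeneous d p \<Longrightarrow> homogeneous d q \<Longrightarrow> homogeneous d (p - q)"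
  using keys_diff[of p q] by (auto simp: homogeneous_def)

lemma homogeneous_sum: "(\<And>a. a \<in> A \<Longrightarrow> homogeneous d (f a)) \<Longrightarrow> homogeneous d (sum f A)"
  by (induction A rule: infinite_finite_induct) (simp_all add: homogeneous_add)

lemma homogeneous_mult: "homogeneous d p \<Longrightarrow> homogeneous e q \<Longrightarrow> homogeneous (d + e) (p * q)"
  using keys_mult[of p q] by (fastforce simp: homogeneous_def mdeg_add)

lemma homogeneous_neg_eq_0: "homogeneous d p \<Longrightarrow> d < 0 \<Longrightarrow> p = 0"
  unfolding homogeneous_def by (metis keys_eq_empty ex_in_conv of_nat_0_le_iff not_less)

definition component :: "int \<Rightarrow> ('v::finite, 'k::comm_ring_1) mpoly \<Rightarrow> ('v, 'k) mpoly" where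
  "component d = Poly_Mapping.mapp (\<lambda>m a. a when int (mdeg m) = d)"

lemma lookup_component:
  "Poly_Mapping.lookup (component d p) m = (Poly_Mapping.lookup p m when int (mdeg m) = d)"
  by (simp add: component_def lookup_mapp when_def in_keys_iff)

interpretation component: additive "component d"
  by standard (rule poly_mapping_eqI, simp add: lookup_component lookup_add when_def)

lemma keys_component:
  "Poly_Mapping.keys (component d p) = {m \<in> Poly_Mapping.keys p. int (mdeg m) = d}"
  by (auto simp: in_keys_iff lookup_component)

lemma homogeneous_component: "homogeneous d (component d p)"
  by (simp add: homogeneous_def keys_component)

lemma component_homogeneous: "homogeneous d p \<Longrightarrow> component d p = p"
  by (rule poly_mapping_eqI) (auto simp: lookup_component homogeneous_def when_def in_keys_iff)

lemma component_mult:
  assumes "homogeneous d p"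
  shows "component (d + e) (p * q) = p * component e q"
proof -
  have "component (d + e) (p * (q - component e q)) = 0"
  proof -
    have "int (mdeg m) \<noteq> d + e" if m: "m \<in> Poly_Mapping.keys (p * (q - component e q))" for m
    proof -
      obtain k n where "m = k + n" "k \<in> Poly_Mapping.keys p"
        and "n \<in> Poly_Mapping.keys (q - component e q)"
        using m keys_mult[of p "q - component e q"] by blast
      moreover from this have "int (mdeg n) \<noteq> e"
        by (auto simp: in_keys_iff lookup_minus lookup_component)
      ultimately show ?thesis
        using assms by (simp add: homogeneous_def mdeg_add)
    qed
    then show ?thesis
      by (auto simp: keys_component simp flip: keys_eq_empty)
  qed
  moreover have "component (d + e) (p * component e q) = p * component e q"
    by (intro component_homogeneous homogeneous_mult assms homogeneous_component)
  ultimately show ?thesis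
    by (simp add: right_diff_distrib component.diff)
qed

lemma homogeneous_mult_cancel:
  fixes p q :: "('v::{finite,linorder}, 'k::idom) mpoly"
  assumes "homogeneous d p" "p \<noteq> 0"
  shows "homogeneous (d + e) (p * q) \<longleftrightarrow> homogeneous e q"
proof
  assume "homogeneous (d + e) (p * q)"
  then have "p * component e q = p * q"
    by (simp add: component_homogeneous flip: component_mult[OF assms(1)])
  then have "component e q = q"
    using assms(2) by simp
  then show "homogeneous e q"
    using homogeneous_component[of e q] by simp
qed (intro homogeneous_mult assms)

definition graded_ideal :: "('v::finite, 'k::comm_ring_1) mpoly set \<Rightarrow> bool" where
  "graded_ideal I \<longleftrightarrow> ideal.subspace I \<and> (\<forall>p\<in>I. \<forall>d. component d p \<in> I)"

lemma graded_edge_ideal: "graded_ideal (edge_ideal \<F>)"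
  unfolding graded_ideal_def
proof (intro conjI ballI allI)
  show "ideal.subspace (edge_ideal \<F>)"
    by (simp add: edge_ideal_eq_span)
  show "component d p \<in> edge_ideal \<F>" if "p \<in> edge_ideal \<F>" for p d
    using that by (simp add: mem_edge_ideal_iff keys_component)
qed

section \<open>The Koszul complex\<close>

lemma koszul_sign_sq [simp]: "koszul_sign k F * koszul_sign k F = 1"
  by (simp add: koszul_sign_def)

lemma koszul_sign_mult_cancel [simp]: "koszul_sign k F * (koszul_sign k F * a) = a"
  by (simp flip: mult.assoc)

lemma koszul_sign_mult_cases: "koszul_sign k F * a = a \<or> koszul_sign k F * a = - a"
  by (simp add: koszul_sign_def minus_one_power_iff)

lemma single_koszul_sign:
  "Poly_Mapping.single 0 (koszul_sign k F) =
    (koszul_sign k F :: ('v::linorder, 'k::comm_ring_1) mpoly)"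
  by (simp add: koszul_sign_def minus_one_power_iff single_uminus)

lemma koszul_sign_insert_self [simp]: "koszul_sign k (insert k F) = koszul_sign k F"
  unfolding koszul_sign_def by (rule arg_cong[where f = "\<lambda>A. (-1) ^ card A"]) auto

lemma koszul_sign_insert:
  fixes F :: "'v::{finite,linorder} set"
  assumes "l \<notin> F"
  shows "koszul_sign k (insert l F) = (if l < k then - koszul_sign k F else koszul_sign k F)"
proof (cases "l < k")
  case True
  then have "{j \<in> insert l F. j < k} = insert l {j \<in> F. j < k}" by auto
  then show ?thesis using assms True by (simp add: koszul_sign_def)
next
  case False
  then have "{j \<in> insert l F. j < k} = {j \<in> F. j < k}" by auto
  then show ?thesis using False by (simp add: koszul_sign_def)
qed

lemma koszul_sign_swap:
  fixes F :: "'v::{finite,linorder} set"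
  assumes "k \<notin> F" "l \<notin> F" "k \<noteq> l"
  shows "koszul_sign k F * koszul_sign l (insert k F) =
    - (koszul_sign l F * koszul_sign k (insert l F))"
  using assms by (auto simp: koszul_sign_insert mult.commute not_less_iff_gr_or_eq)

lemma koszul_d_eq: "koszul_d c G = (\<Sum>k\<in>- G. koszul_sign k G * (var k * c (insert k G)))"
  by (simp add: koszul_d_def single_koszul_sign mult.assoc Compl_eq_Diff_UNIV)

interpretation koszul_d: additive koszul_d
  by standard (simp add: fun_eq_iff koszul_d_eq distrib_left sum.distrib)

lemma koszul_d_mult: "koszul_d (\<lambda>F. p * c F) = (\<lambda>G. p * koszul_d c G)"
  by (rule ext) (simp add: koszul_d_eq sum_distrib_left mult_ac)

lemma sum_antisymmetric_eq_0:
  fixes f :: "'a::linorder \<Rightarrow> 'a \<Rightarrow> 'b::ab_group_add"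
  assumes antisym: "\<And>k l. k \<in> A \<Longrightarrow> l \<in> A \<Longrightarrow> k \<noteq> l \<Longrightarrow> f k l = - f l k"
    and diag: "\<And>k. k \<in> A \<Longrightarrow> f k k = 0"
  shows "(\<Sum>k\<in>A. \<Sum>l\<in>A. f k l) = 0"
proof -
  define g where "g k l = (if k < l then f k l else 0)" for k l
  have "f k l = g k l - g l k" if "k \<in> A" "l \<in> A" for k l
    using antisym[OF that] diag that by (cases k l rule: linorder_cases) (auto simp: g_def)
  then have "(\<Sum>k\<in>A. \<Sum>l\<in>A. f k l) = (\<Sum>k\<in>A. \<Sum>l\<in>A. g k l) - (\<Sum>k\<in>A. \<Sum>l\<in>A. g l k)"
    by (simp add: sum_subtractf)
  then show ?thesis
    using sum.swap[of "\<lambda>k l. g l k" A A] by simp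
qed

lemma koszul_d_koszul_d: "koszul_d (koszul_d c) = 0"
proof
  fix G
  define f where "f k l = (if k = l then 0 else koszul_sign k G * koszul_sign l (insert k G) *
    (var k * (var l * c (insert l (insert k G)))))" for k l
  have "koszul_d (koszul_d c) G = (\<Sum>k\<in>- G. \<Sum>l\<in>- insert k G. f k l)"
    unfolding koszul_d_eq sum_distrib_left
    by (intro sum.cong refl) (auto simp: f_def mult_ac)
  also have "\<dots> = (\<Sum>k\<in>- G. \<Sum>l\<in>- G. f k l)"
    by (intro sum.cong refl sum.mono_neutral_left) (auto simp: f_def)
  also have "\<dots> = 0"
  proof (rule sum_antisymmetric_eq_0)
    fix k l assume distinct: "k \<in> - G" "l \<in> - G" "k \<noteq> l"
    then have "koszul_sign k G * koszul_sign l (insert k G) =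
        - (koszul_sign l G * (koszul_sign k (insert l G) :: ('a, 'b) mpoly))"
      by (intro koszul_sign_swap) auto
    then show "f k l = - f l k"
      using distinct by (simp add: f_def insert_commute mult.left_commute)
  qed (simp add: f_def)
  finally show "koszul_d (koszul_d c) G = 0 G" by simp
qed

lemma zero_in_koszul_chains:
  assumes "0 \<in> I"
  shows "0 \<in> koszul_chains I i j"
  using assms by (simp add: koszul_chains_def)

lemma koszul_chains_add:
  assumes "ideal.subspace I" "a \<in> koszul_chains I i j" "b \<in> koszul_chains I i j"
  shows "a + b \<in> koszul_chains I i j"
  using assms by (simp add: koszul_chains_def homogeneous_add ideal.subspace_add)

lemma koszul_chains_diff:
  assumes "ideal.subspace I" "a \<in> koszul_chains I i j" "b \<in> koszul_chains I i j"
  shows "a - b \<in> koszul_chains I i j"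
  using assms by (simp add: koszul_chains_def homogeneous_diff ideal.subspace_diff)

lemma koszul_chains_uminus:
  assumes "ideal.subspace I" "a \<in> koszul_chains I i j"
  shows "- a \<in> koszul_chains I i j"
  using koszul_chains_diff[OF assms(1) zero_in_koszul_chains assms(2)] assms(1)
  by (simp add: ideal.subspace_0)

lemma koszul_chains_Int: "koszul_chains (I \<inter> J) i j = koszul_chains I i j \<inter> koszul_chains J i j"
  by (auto simp: koszul_chains_def)

lemma koszul_d_in_koszul_chains:
  assumes subspace: "ideal.subspace I" and chain: "c \<in> koszul_chains I (Suc i) j"
  shows "koszul_d c \<in> koszul_chains I i j"
  unfolding koszul_chains_def
proof (intro CollectI allI conjI impI)
  fix G
  have "koszul_sign k G * (var k * c (insert k G)) = 0" if "k \<notin> G" "card G \<noteq> i" for k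
    using that chain by (simp add: koszul_chains_def)
  then show "koszul_d c G = 0" if "card G \<noteq> i"
    using that by (simp add: koszul_d_eq)
  show "koszul_d c G \<in> I"
    using subspace chain
    by (simp add: koszul_d_eq koszul_chains_def ideal.subspace_sum ideal.subspace_scale)
  have "homogeneous (j - int i) (koszul_sign k G * (var k * c (insert k G)))" for k
  proof -
    have "homogeneous (1 + (j - int (Suc i))) (var k * c (insert k G))"
      using chain by (intro homogeneous_mult homogeneous_var) (simp add: koszul_chains_def)
    then show ?thesis
      using koszul_sign_mult_cases[of k G "var k * c (insert k G)"]
      by (auto simp: homogeneous_uminus)
  qed
  then show "homogeneous (j - int i) (koszul_d c G)"
    unfolding koszul_d_eq by (intro homogeneous_sum)
qed

lemma koszul_d_degree_0_chain:
  assumes "c \<in> koszul_chains I 0 j"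
  shows "koszul_d c = 0"
  using assms by (intro ext) (simp add: koszul_d_eq koszul_chains_def)

lemma tor_nonzero_iff:
  "tor_nonzero I i j \<longleftrightarrow>
    (\<exists>c\<in>koszul_chains I i j. koszul_d c = 0 \<and> (\<forall>b\<in>koszul_chains I (Suc i) j. koszul_d b \<noteq> c))"
  unfolding tor_nonzero_def zero_fun_def by blast

lemma not_tor_nonzeroE:
  assumes "\<not> tor_nonzero I i j" "c \<in> koszul_chains I i j" "koszul_d c = 0"
  obtains b where "b \<in> koszul_chains I (Suc i) j" "koszul_d b = c"
  using assms unfolding tor_nonzero_iff by blast

section \<open>Tor of sums, multiples and the ring itself\<close>

lemma koszul_chains_plus:
  assumes "graded_ideal I" "graded_ideal J"
  shows "koszul_chains (I + J) i j = koszul_chains I i j + koszul_chains J i j"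
proof (intro equalityI subsetI)
  fix c assume chain: "c \<in> koszul_chains (I + J) i j"
  then have "\<forall>F. \<exists>p q. p \<in> I \<and> q \<in> J \<and> c F = p + q"
    by (fastforce simp: koszul_chains_def set_plus_def)
  then obtain p q where split: "\<And>F. p F \<in> I" "\<And>F. q F \<in> J" "\<And>F. c F = p F + q F"
    by metis
  define a where "a F = (if card F = i then component (j - int i) (p F) else 0)" for F
  define b where "b F = (if card F = i then component (j - int i) (q F) else 0)" for F
  have "a \<in> koszul_chains I i j" "b \<in> koszul_chains J i j"
    using assms split(1,2) ideal.subspace_0
    by (auto simp: koszul_chains_def a_def b_def graded_ideal_def homogeneous_component)
  moreover have "c F = a F + b F" for F
  proof (cases "card F = i")
    case True
    have "c F = component (j - int i) (p F + q F)"
      using chain by (simp add: koszul_chains_def component_homogeneous flip: split(3))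
    then show ?thesis using True by (simp add: a_def b_def component.add)
  qed (use chain in \<open>simp add: koszul_chains_def a_def b_def\<close>)
  ultimately show "c \<in> koszul_chains I i j + koszul_chains J i j"
    unfolding set_plus_def by (auto simp: fun_eq_iff)
next
  fix c assume "c \<in> koszul_chains I i j + koszul_chains J i j"
  then obtain a b where "a \<in> koszul_chains I i j" "b \<in> koszul_chains J i j" "c = a + b"
    by (rule set_plus_elim)
  then show "c \<in> koszul_chains (I + J) i j"
    by (simp add: koszul_chains_def homogeneous_add set_plus_intro)
qed

lemma koszul_d_summand_lift_Int:
  assumes subspaces: "ideal.subspace I" "ideal.subspace J"
    and exact: "\<And>i'. i = Suc i' \<Longrightarrow> \<not> tor_nonzero (I \<inter> J) i' j"
    and chains: "a \<in> koszul_chains I i j" "b \<in> koszul_chains J i j"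
    and cycle: "koszul_d (a + b) = 0"
  obtains e where "e \<in> koszul_chains (I \<inter> J) i j" "koszul_d e = koszul_d a"
proof (cases i)
  case 0
  moreover have "0 \<in> koszul_chains (I \<inter> J) i j"
    by (intro zero_in_koszul_chains) (simp add: subspaces ideal.subspace_0)
  ultimately show thesis
    using that[of 0] chains(1) koszul_d_degree_0_chain[of a] by (simp add: koszul_d.zero)
next
  case (Suc i')
  have "koszul_d a = - koszul_d b"
    using cycle by (simp add: koszul_d.add eq_neg_iff_add_eq_0)
  moreover have "koszul_d a \<in> koszul_chains I i' j" "koszul_d b \<in> koszul_chains J i' j"
    using chains subspaces Suc by (auto intro: koszul_d_in_koszul_chains)
  ultimately have "koszul_d a \<in> koszul_chains (I \<inter> J) i' j"
    using subspaces by (simp add: koszul_chains_Int koszul_chains_uminus)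
  from not_tor_nonzeroE[OF exact[OF Suc] this koszul_d_koszul_d] show thesis
    using that Suc by auto
qed

text \<open>Exactness of the Mayer--Vietoris sequence of \<open>I\<close> and \<open>J\<close> at \<open>Tor\<^sub>i(I + J, K)\<^sub>j\<close>.\<close>

lemma tor_nonzero_plus:
  assumes graded: "graded_ideal I" "graded_ideal J" and tor: "tor_nonzero (I + J) i j"
  shows "tor_nonzero I i j \<or> tor_nonzero J i j \<or> (\<exists>i'. i = Suc i' \<and> tor_nonzero (I \<inter> J) i' j)"
proof (rule ccontr)
  assume "\<not> ?thesis"
  then have exact: "\<not> tor_nonzero I i j" "\<not> tor_nonzero J i j"
    "\<And>i'. i = Suc i' \<Longrightarrow> \<not> tor_nonzero (I \<inter> J) i' j"
    by auto
  have subspaces: "ideal.subspace I" "ideal.subspace J"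
    using graded by (simp_all add: graded_ideal_def)
  obtain c where cycle: "c \<in> koszul_chains (I + J) i j" "koszul_d c = 0"
    and not_boundary: "\<And>b. b \<in> koszul_chains (I + J) (Suc i) j \<Longrightarrow> koszul_d b \<noteq> c"
    using tor unfolding tor_nonzero_iff by blast
  obtain a b where chains: "a \<in> koszul_chains I i j" "b \<in> koszul_chains J i j"
    and sum: "c = a + b"
    using cycle(1) unfolding koszul_chains_plus[OF graded] by (rule set_plus_elim)
  obtain e where lift: "e \<in> koszul_chains (I \<inter> J) i j" "koszul_d e = koszul_d a"
    using koszul_d_summand_lift_Int[OF subspaces exact(3) chains] cycle(2) sum by blast
  have "a - e \<in> koszul_chains I i j" "b + e \<in> koszul_chains J i j"
    using chains lift(1) subspaces
    by (simp_all add: koszul_chains_Int koszul_chains_diff koszul_chains_add)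
  moreover have "koszul_d (a - e) = 0" "koszul_d (b + e) = 0"
    using cycle(2) by (simp_all add: koszul_d.add koszul_d.diff lift(2) sum add.commute)
  ultimately obtain a' b' where "a' \<in> koszul_chains I (Suc i) j" "koszul_d a' = a - e"
    and "b' \<in> koszul_chains J (Suc i) j" "koszul_d b' = b + e"
    using exact(1,2) by (metis not_tor_nonzeroE)
  then have "a' + b' \<in> koszul_chains (I + J) (Suc i) j" "koszul_d (a' + b') = c"
    by (auto simp: koszul_chains_plus[OF graded] koszul_d.add sum)
  then show False using not_boundary by blast
qed

lemma koszul_chains_mult_image:
  fixes I :: "('v::{finite,linorder}, 'k::idom) mpoly set"
  assumes "homogeneous d f" "f \<noteq> 0"
  shows "koszul_chains ((*) f ` I) i (j + d) = (\<lambda>c F. f * c F) ` koszul_chains I i j"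
proof (intro equalityI subsetI)
  fix c assume chain: "c \<in> koszul_chains ((*) f ` I) i (j + d)"
  then have "\<forall>F. \<exists>p\<in>I. c F = f * p"
    by (auto simp: koszul_chains_def)
  then obtain q where quotient: "\<And>F. q F \<in> I" "\<And>F. c F = f * q F"
    by metis
  have "q F = 0" if "card F \<noteq> i" for F
    using chain quotient(2)[of F] assms(2) that by (simp add: koszul_chains_def)
  moreover have "homogeneous (d + (j - int i)) (f * q F)" for F
    using chain by (simp add: koszul_chains_def algebra_simps flip: quotient(2))
  then have "homogeneous (j - int i) (q F)" for F
    using homogeneous_mult_cancel[OF assms] by blast
  ultimately have "q \<in> koszul_chains I i j"
    using quotient(1) by (simp add: koszul_chains_def)
  then show "c \<in> (\<lambda>c F. f * c F) ` koszul_chains I i j"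
    using quotient(2) by (intro image_eqI[where x = q]) auto
next
  fix c assume "c \<in> (\<lambda>c F. f * c F) ` koszul_chains I i j"
  then obtain b where chain: "b \<in> koszul_chains I i j" and image: "c = (\<lambda>F. f * b F)"
    by blast
  have "homogeneous (d + (j - int i)) (f * b F)" for F
    using chain by (intro homogeneous_mult assms(1)) (simp add: koszul_chains_def)
  then show "c \<in> koszul_chains ((*) f ` I) i (j + d)"
    using chain by (auto simp: koszul_chains_def image algebra_simps)
qed

lemma tor_nonzero_mult_image:
  fixes I :: "('v::{finite,linorder}, 'k::field) mpoly set"
  assumes "homogeneous d f" "f \<noteq> 0"
  shows "tor_nonzero ((*) f ` I) i (j + d) \<longleftrightarrow> tor_nonzero I i j"
proof -
  have "(\<lambda>F. f * b F) = (\<lambda>F. f * c F) \<longleftrightarrow> b = c" "(\<lambda>F. f * c F) = 0 \<longleftrightarrow> c = 0"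
    for b c :: "'v set \<Rightarrow> ('v, 'k) mpoly"
    using assms(2) by (simp_all add: fun_eq_iff)
  then show ?thesis
    by (simp add: tor_nonzero_iff koszul_chains_mult_image[OF assms] koszul_d_mult)
qed

section \<open>Acyclicity of the Koszul complex\<close>

text \<open>Division by \<open>x\<close> gives a chain homotopy between the identity and the projection onto the part
  of the complex that is free of \<open>x\<close>. Doing this for all variables leaves only the constants.\<close>

definition div_var :: "'v::finite \<Rightarrow> ('v, 'k::comm_ring_1) mpoly \<Rightarrow> ('v, 'k) mpoly" where
  "div_var x = Poly_Mapping.map_key ((+) (sqfree_mon {x}))"

lemma lookup_div_var:
  "Poly_Mapping.lookup (div_var x p) m = Poly_Mapping.lookup p (sqfree_mon {x} + m)"
  by (simp add: div_var_def map_key.rep_eq)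

interpretation div_var: additive "div_var x"
  by standard (rule poly_mapping_eqI, simp add: lookup_div_var lookup_add)

lemma div_var_koszul_sign_mult: "div_var x (koszul_sign k F * p) = koszul_sign k F * div_var x p"
  by (simp add: koszul_sign_def minus_one_power_iff div_var.minus)

lemma lookup_single_mult_add:
  fixes p :: "'a::cancel_comm_monoid_add \<Rightarrow>\<^sub>0 'b::comm_semiring_1"
  shows "Poly_Mapping.lookup (Poly_Mapping.single n 1 * p) (n + m) = Poly_Mapping.lookup p m"
proof -
  have "Poly_Mapping.single n 1 * p =
      (\<Sum>k\<in>Poly_Mapping.keys p. Poly_Mapping.single (n + k) (Poly_Mapping.lookup p k))"
    by (subst (1) poly_mapping_sum_monomials[of p, symmetric])
      (simp add: sum_distrib_left mult_single)
  then show ?thesis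
    by (simp add: lookup_sum lookup_single when_def in_keys_iff)
qed

lemma lookup_var_mult_add:
  "Poly_Mapping.lookup (var x * p) (sqfree_mon {x} + m) = Poly_Mapping.lookup p m"
  by (simp add: var_eq_single lookup_single_mult_add)

lemma lookup_var_mult_eq_0:
  fixes p :: "('v::finite, 'k::comm_ring_1) mpoly"
  assumes "x \<notin> Poly_Mapping.keys m"
  shows "Poly_Mapping.lookup (var x * p) m = 0"
proof -
  have "m \<notin> Poly_Mapping.keys (var x * p)"
    using assms keys_mult[of "var x" p]
    by (auto simp: var_eq_single keys_monomial_add split: if_splits)
  then show ?thesis by (simp add: in_keys_iff)
qed

lemma div_var_var_mult_self [simp]: "div_var x (var x * p) = p"
  by (rule poly_mapping_eqI) (simp add: lookup_div_var lookup_var_mult_add)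

lemma div_var_var_mult_neq:
  fixes p :: "('v::finite, 'k::comm_ring_1) mpoly"
  assumes "k \<noteq> x"
  shows "div_var x (var k * p) = var k * div_var x p"
proof (rule poly_mapping_eqI)
  fix m :: "'v \<Rightarrow>\<^sub>0 nat"
  show "Poly_Mapping.lookup (div_var x (var k * p)) m = Poly_Mapping.lookup (var k * div_var x p) m"
  proof (cases "k \<in> Poly_Mapping.keys m")
    case True
    then obtain n where "m = sqfree_mon {k} + n"
      using in_keys_iff_sqfree_mon_add by blast
    then show ?thesis
      by (simp add: lookup_div_var lookup_var_mult_add add.left_commute)
  next
    case False
    then show ?thesis
      using assms by (simp add: lookup_div_var lookup_var_mult_eq_0 keys_monomial_add)
  qed
qed

lemma lookup_var_mult_div_var:
  "Poly_Mapping.lookup (var x * div_var x p) m =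
    (Poly_Mapping.lookup p m when x \<in> Poly_Mapping.keys m)"
proof (cases "x \<in> Poly_Mapping.keys m")
  case True
  then obtain n where "m = sqfree_mon {x} + n"
    using in_keys_iff_sqfree_mon_add by blast
  then show ?thesis
    using True by (simp add: lookup_var_mult_add lookup_div_var)
qed (simp add: lookup_var_mult_eq_0)

lemma homogeneous_div_var:
  assumes "homogeneous (d + 1) p"
  shows "homogeneous d (div_var x p)"
  unfolding homogeneous_def
proof
  fix m assume "m \<in> Poly_Mapping.keys (div_var x p)"
  then have "int (mdeg (sqfree_mon {x} + m)) = d + 1"
    using assms by (simp add: homogeneous_def in_keys_iff lookup_div_var)
  then show "int (mdeg m) = d"
    by (simp add: mdeg_add mdeg_sqfree_mon)
qed

definition koszul_homotopy ::
  "'v \<Rightarrow> ('v::{finite,linorder} set \<Rightarrow> ('v, 'k::comm_ring_1) mpoly) \<Rightarrow> 'v set \<Rightarrow> ('v, 'k) mpoly" where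
  "koszul_homotopy x c = (\<lambda>F. if x \<in> F then koszul_sign x F * div_var x (c (F - {x})) else 0)"

lemma koszul_homotopy_0 [simp]: "koszul_homotopy x 0 = 0"
  by (simp add: koszul_homotopy_def fun_eq_iff div_var.zero)

lemma koszul_homotopy_chains:
  assumes "c \<in> koszul_chains UNIV i j"
  shows "koszul_homotopy x c \<in> koszul_chains UNIV (Suc i) j"
  unfolding koszul_chains_def
proof (intro CollectI allI conjI impI UNIV_I)
  fix F
  show "koszul_homotopy x c F = 0" if "card F \<noteq> Suc i"
  proof (cases "x \<in> F")
    case True
    then have "card (F - {x}) \<noteq> i" using that card_Suc_Diff1[of F x] by fastforce
    then have "c (F - {x}) = 0" using assms unfolding koszul_chains_def by blast
    then show ?thesis by (simp add: koszul_homotopy_def div_var.zero)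
  qed (simp add: koszul_homotopy_def)
  have "homogeneous (j - int (Suc i)) (div_var x (c (F - {x})))"
    using assms by (intro homogeneous_div_var) (simp add: koszul_chains_def)
  then show "homogeneous (j - int (Suc i)) (koszul_homotopy x c F)"
    using koszul_sign_mult_cases[of x F "div_var x (c (F - {x}))"]
    by (auto simp: koszul_homotopy_def homogeneous_uminus)
qed

lemma koszul_homotopy_identity_in:
  fixes c :: "'v::{finite,linorder} set \<Rightarrow> ('v, 'k::comm_ring_1) mpoly"
  assumes "x \<in> G"
  shows "koszul_d (koszul_homotopy x c) G + koszul_homotopy x (koszul_d c) G = c G"
proof -
  define H where "H = G - {x}"
  have G: "G = insert x H" and "x \<notin> H" and Compl_H: "- H = insert x (- G)"
    using assms by (auto simp: H_def)
  define q where "q k = var k * div_var x (c (insert k H))" for k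
  have homotopy_term: "koszul_sign k G * (var k * koszul_homotopy x c (insert k G)) =
      - (koszul_sign x H * (koszul_sign k H * q k))" if k: "k \<in> - G" for k
  proof -
    have "koszul_homotopy x c (insert k G) =
        koszul_sign x (insert k H) * div_var x (c (insert k H))"
      using k G \<open>x \<notin> H\<close> by (simp add: koszul_homotopy_def insert_commute[of k x] insert_Diff_if)
    then have "koszul_sign k G * (var k * koszul_homotopy x c (insert k G)) =
        koszul_sign k G * koszul_sign x (insert k H) * q k"
      by (simp add: q_def mult_ac)
    moreover have "koszul_sign k G * koszul_sign x (insert k H) =
        - (koszul_sign x H * (koszul_sign k H :: ('v, 'k) mpoly))"
      using k G \<open>x \<notin> H\<close> by (auto simp: koszul_sign_insert mult.commute)
    ultimately show ?thesis
      by (simp add: mult.assoc)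
  qed
  have differential_term: "div_var x (var k * c (insert k H)) = q k" if "k \<in> - G" for k
  proof -
    have "k \<noteq> x" using that assms by auto
    then show ?thesis by (simp add: q_def div_var_var_mult_neq)
  qed
  have "koszul_homotopy x (koszul_d c) G = koszul_sign x H * div_var x (koszul_d c H)"
    using \<open>x \<notin> H\<close> by (simp add: koszul_homotopy_def G)
  also have "\<dots> = c G + (\<Sum>k\<in>- G. koszul_sign x H * (koszul_sign k H * q k))"
    using assms
    by (simp add: koszul_d_eq Compl_H div_var.add div_var.sum div_var_koszul_sign_mult
        differential_term distrib_left sum_distrib_left flip: G)
  finally show ?thesis
    by (simp add: koszul_d_eq homotopy_term sum_negf)
qed

lemma koszul_homotopy_identity_notin:
  assumes "x \<notin> G"
  shows "koszul_d (koszul_homotopy x c) G + koszul_homotopy x (koszul_d c) G =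
    var x * div_var x (c G)"
proof -
  have "koszul_d (koszul_homotopy x c) G =
      (\<Sum>k\<in>{x}. koszul_sign k G * (var k * koszul_homotopy x c (insert k G)))"
    unfolding koszul_d_eq
    by (rule sum.mono_neutral_right) (use assms in \<open>auto simp: koszul_homotopy_def\<close>)
  then show ?thesis
    using assms by (simp add: koszul_homotopy_def mult.left_commute[of "var x"])
qed

definition free_of :: "'v set \<Rightarrow> ('v set \<Rightarrow> ('v, 'k::zero) mpoly) \<Rightarrow> bool" where
  "free_of X c \<longleftrightarrow> (\<forall>F. \<forall>m\<in>Poly_Mapping.keys (c F). (F \<union> Poly_Mapping.keys m) \<inter> X = {})"

lemma free_of_insert_homotopy:
  fixes c :: "'v::{finite,linorder} set \<Rightarrow> ('v, 'k::comm_ring_1) mpoly"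
  assumes "free_of X c" "koszul_d c = 0"
  shows "free_of (insert x X) (c - koszul_d (koszul_homotopy x c))"
proof -
  have residue: "(c - koszul_d (koszul_homotopy x c)) F =
      (if x \<in> F then 0 else c F - var x * div_var x (c F))" for F
    using koszul_homotopy_identity_in[of x F c] koszul_homotopy_identity_notin[of x F c] assms(2)
    by simp
  have "m \<in> Poly_Mapping.keys (c F) \<and> x \<notin> F \<union> Poly_Mapping.keys m"
    if "m \<in> Poly_Mapping.keys ((c - koszul_d (koszul_homotopy x c)) F)" for F m
    using that unfolding residue
    by (auto simp: in_keys_iff lookup_minus lookup_var_mult_div_var when_def split: if_splits)
  then show ?thesis
    using assms(1) unfolding free_of_def by blast
qed

lemma koszul_cycle_homologous_free_of:
  fixes c :: "'v::{finite,linorder} set \<Rightarrow> ('v, 'k::comm_ring_1) mpoly"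
  assumes cycle: "c \<in> koszul_chains UNIV i j" "koszul_d c = 0"
  shows "\<exists>b\<in>koszul_chains UNIV (Suc i) j. free_of X (c - koszul_d b)"
  using finite[of X]
proof (induction X rule: finite_induct)
  case empty
  have "free_of {} (c - koszul_d 0)"
    by (simp add: free_of_def)
  moreover have "0 \<in> koszul_chains UNIV (Suc i) j"
    by (intro zero_in_koszul_chains) simp
  ultimately show ?case by blast
next
  case (insert x X)
  then obtain b where residue: "b \<in> koszul_chains UNIV (Suc i) j" "free_of X (c - koszul_d b)"
    by blast
  define h where "h = koszul_homotopy x (c - koszul_d b)"
  have "h \<in> koszul_chains UNIV (Suc i) j"
    unfolding h_def
    by (intro koszul_homotopy_chains koszul_chains_diff cycle
        koszul_d_in_koszul_chains residue) auto
  then have "b + h \<in> koszul_chains UNIV (Suc i) j"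
    by (intro koszul_chains_add residue) auto
  moreover have "koszul_d (c - koszul_d b) = 0"
    by (simp add: koszul_d.diff cycle(2) koszul_d_koszul_d)
  from free_of_insert_homotopy[OF residue(2) this, of x]
  have "free_of (insert x X) (c - koszul_d (b + h))"
    by (simp add: h_def koszul_d.add diff_diff_eq)
  ultimately show ?case by blast
qed

lemma tor_nonzero_UNIV_imp_eq:
  assumes "tor_nonzero (UNIV :: ('v::{finite,linorder}, 'k::field) mpoly set) i j"
  shows "j = int i"
proof (rule ccontr)
  assume "j \<noteq> int i"
  obtain c :: "'v set \<Rightarrow> ('v, 'k) mpoly" where cycle: "c \<in> koszul_chains UNIV i j" "koszul_d c = 0"
    and not_boundary: "\<And>b. b \<in> koszul_chains UNIV (Suc i) j \<Longrightarrow> koszul_d b \<noteq> c"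
    using assms unfolding tor_nonzero_iff by blast
  obtain b where residue: "b \<in> koszul_chains UNIV (Suc i) j" "free_of UNIV (c - koszul_d b)"
    using koszul_cycle_homologous_free_of[OF cycle] by blast
  have "c - koszul_d b \<in> koszul_chains UNIV i j"
    by (intro koszul_chains_diff cycle koszul_d_in_koszul_chains residue) auto
  then have degree: "homogeneous (j - int i) ((c - koszul_d b) F)" for F
    by (simp add: koszul_chains_def)
  have "(c - koszul_d b) F = 0" for F
  proof (rule ccontr)
    assume "(c - koszul_d b) F \<noteq> 0"
    then obtain m where m: "m \<in> Poly_Mapping.keys ((c - koszul_d b) F)"
      by (metis ex_in_conv keys_eq_empty)
    then have "m = 0"
      using residue(2) unfolding free_of_def by (metis Int_UNIV_right Un_empty keys_eq_empty)
    moreover have "int (mdeg m) = j - int i"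
      using degree m unfolding homogeneous_def by blast
    ultimately show False
      using \<open>j \<noteq> int i\<close> by (simp add: mdeg_def)
  qed
  then have "koszul_d b = c" by (simp add: fun_eq_iff)
  then show False using not_boundary residue(1) by blast
qed

section \<open>Bounds on the regularity\<close>

definition cm_regular :: "('v::{finite,linorder}, 'k::field) mpoly set \<Rightarrow> int \<Rightarrow> bool" where
  "cm_regular I r \<longleftrightarrow> (\<forall>i j. tor_nonzero I i j \<longrightarrow> j - int i \<le> r)"

lemma cm_regular_mono: "cm_regular I r \<Longrightarrow> r \<le> s \<Longrightarrow> cm_regular I s"
  unfolding cm_regular_def by force

lemma cm_regular_zero: "cm_regular {0} r"
proof -
  have "c = 0" if "c \<in> koszul_chains {0} i j"
    for c :: "'v::{finite,linorder} set \<Rightarrow> ('v, 'k::field) mpoly" and i j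
    using that by (simp add: koszul_chains_def fun_eq_iff)
  then show ?thesis
    using zero_in_koszul_chains[of "{0}"] koszul_d.zero
    by (fastforce simp: cm_regular_def tor_nonzero_iff)
qed

lemma cm_regular_UNIV: "cm_regular UNIV 0"
  unfolding cm_regular_def by (auto dest: tor_nonzero_UNIV_imp_eq)

lemma cm_regular_plus:
  assumes "graded_ideal I" "graded_ideal J" "cm_regular I r" "cm_regular J r"
    and "cm_regular (I \<inter> J) (r + 1)"
  shows "cm_regular (I + J) r"
  unfolding cm_regular_def
proof (intro allI impI)
  fix i j assume "tor_nonzero (I + J) i j"
  from tor_nonzero_plus[OF assms(1,2) this] show "j - int i \<le> r"
    using assms(3-5) unfolding cm_regular_def by fastforce
qed

lemma cm_regular_mult_image:
  assumes "homogeneous d f" "f \<noteq> 0" "cm_regular I r"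
  shows "cm_regular ((*) f ` I) (r + d)"
  unfolding cm_regular_def
proof (intro allI impI)
  fix i j assume "tor_nonzero ((*) f ` I) i j"
  then have "tor_nonzero I i (j - d)"
    using tor_nonzero_mult_image[OF assms(1,2), of I i "j - d"] by simp
  then show "j - int i \<le> r + d"
    using assms(3) unfolding cm_regular_def by force
qed

lemma tor_nonzero_imp_le:
  assumes "tor_nonzero I i j"
  shows "int i \<le> j"
proof (rule ccontr)
  assume "\<not> int i \<le> j"
  obtain c where chain: "c \<in> koszul_chains I i j"
    and not_boundary: "\<And>b. b \<in> koszul_chains I (Suc i) j \<Longrightarrow> koszul_d b \<noteq> c"
    using assms unfolding tor_nonzero_iff by blast
  have "c F \<in> I" "homogeneous (j - int i) (c F)" for F
    using chain unfolding koszul_chains_def by blast+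
  moreover from this have "c F = 0" for F
    using \<open>\<not> int i \<le> j\<close> homogeneous_neg_eq_0 by force
  ultimately have "0 \<in> I" "c = 0"
    by (metis, simp add: fun_eq_iff)
  then show False
    using not_boundary[OF zero_in_koszul_chains] koszul_d.zero by blast
qed

text \<open>A nonzero homogeneous element of least degree is a minimal generator.\<close>

lemma graded_ideal_ex_tor_nonzero_0:
  fixes I :: "('v::{finite,linorder}, 'k::field) mpoly set"
  assumes "graded_ideal I" "I \<noteq> {0}"
  shows "\<exists>j. tor_nonzero I 0 j"
proof -
  define D where "D d \<longleftrightarrow> (\<exists>p\<in>I. p \<noteq> 0 \<and> homogeneous (int d) p)" for d
  have "0 \<in> I" using assms(1) by (simp add: graded_ideal_def ideal.subspace_0)
  then obtain p where "p \<in> I" "p \<noteq> 0" using assms(2) by blast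
  then obtain m where "m \<in> Poly_Mapping.keys p" using keys_eq_empty by blast
  then have "D (mdeg m)"
    unfolding D_def using assms(1) \<open>p \<in> I\<close>
    by (intro bexI[of _ "component (int (mdeg m)) p"])
      (auto simp: graded_ideal_def homogeneous_component keys_component simp flip: keys_eq_empty)
  then obtain d where "D d" and least: "\<And>e. D e \<Longrightarrow> d \<le> e"
    by (metis LeastI Least_le)
  then obtain q where q: "q \<in> I" "q \<noteq> 0" "homogeneous (int d) q"
    unfolding D_def by blast
  define c :: "'v set \<Rightarrow> ('v, 'k) mpoly" where "c F = (if F = {} then q else 0)" for F
  have chain: "c \<in> koszul_chains I 0 (int d)"
    using q \<open>0 \<in> I\<close> by (auto simp: koszul_chains_def c_def)
  have "b = 0" if one_chain: "b \<in> koszul_chains I (Suc 0) (int d)" for b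
  proof
    fix F
    have "b F \<in> I" "homogeneous (int d - 1) (b F)"
      using one_chain by (simp_all add: koszul_chains_def)
    then show "b F = 0 F"
      using least[of "d - 1"] homogeneous_neg_eq_0[of "int d - 1" "b F"]
      by (cases d) (auto simp: D_def)
  qed
  moreover have "c \<noteq> 0"
    using q(2) by (auto simp: c_def fun_eq_iff)
  ultimately have "tor_nonzero I 0 (int d)"
    using chain koszul_d_degree_0_chain[OF chain] koszul_d.zero
    by (auto simp: tor_nonzero_iff intro!: bexI[of _ c])
  then show ?thesis ..
qed

lemma cm_regular_imp_reg_le:
  assumes "graded_ideal I" "cm_regular I r" "1 \<le> r"
  shows "reg I \<le> r"
proof (cases "I = {0}")
  case True
  then show ?thesis using assms(3) by (simp add: reg_def)
next
  case False
  let ?X = "{j - int i | i j. tor_nonzero I i j}"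
  have bound: "\<forall>s\<in>?X. s \<le> r"
    using assms(2) unfolding cm_regular_def by blast
  moreover have "?X \<subseteq> {0..r}"
    using bound tor_nonzero_imp_le[of I] by fastforce
  then have "finite ?X"
    by (rule finite_subset) simp
  moreover have "?X \<noteq> {}"
    using graded_ideal_ex_tor_nonzero_0[OF assms(1) False] by blast
  ultimately have "Max ?X \<le> r" by simp
  then show ?thesis using False by (simp add: reg_def)
qed

section \<open>Splitting a squarefree monomial ideal at a variable\<close>

text \<open>The argument \<open>K\<close> only carries the coefficient field.\<close>

definition edge_regular :: "'k::field itself \<Rightarrow> 'v::{finite,linorder} set set \<Rightarrow> int \<Rightarrow> bool" where
  "edge_regular K \<F> r \<longleftrightarrow> cm_regular (edge_ideal \<F> :: ('v, 'k) mpoly set) r"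

lemma edge_regular_mono: "edge_regular K \<F> r \<Longrightarrow> r \<le> s \<Longrightarrow> edge_regular K \<F> s"
  unfolding edge_regular_def by (rule cm_regular_mono)

lemma edge_regular_empty: "edge_regular K {} r"
  by (simp add: edge_regular_def cm_regular_zero)

lemma edge_regular_UNIV: "{} \<in> \<F> \<Longrightarrow> 0 \<le> r \<Longrightarrow> edge_regular K \<F> r"
  unfolding edge_regular_def by (simp add: edge_ideal_eq_UNIV cm_regular_mono[OF cm_regular_UNIV])

lemma edge_regular_cong:
  assumes "\<And>F. F \<in> \<F> \<Longrightarrow> \<exists>G\<in>\<G>. G \<subseteq> F" "\<And>G. G \<in> \<G> \<Longrightarrow> \<exists>F\<in>\<F>. F \<subseteq> G"
  shows "edge_regular K \<F> r \<longleftrightarrow> edge_regular K \<G> r"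
  by (simp add: edge_regular_def edge_ideal_eqI[OF assms])

lemma edge_regular_insert_image:
  fixes K :: "'k::field itself" and \<F> :: "'v::{finite,linorder} set set"
  assumes "x \<notin> \<Union>\<F>" "edge_regular K \<F> r"
  shows "edge_regular K (insert x ` \<F>) (r + 1)"
proof -
  have "var x \<noteq> (0 :: ('v, 'k) mpoly)"
    by (simp add: var_eq_single flip: keys_eq_empty)
  then show ?thesis
    using assms(2) cm_regular_mult_image[OF homogeneous_var]
    unfolding edge_regular_def edge_ideal_insert_image[OF assms(1)] by blast
qed

text \<open>On edge ideals, contracting \<open>X\<close> is the colon by the product of the variables of \<open>X\<close>.\<close>

definition del_verts :: "'v set set \<Rightarrow> 'v set \<Rightarrow> 'v set set" where
  "del_verts \<F> X = {F \<in> \<F>. F \<inter> X = {}}"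

definition contract :: "'v set set \<Rightarrow> 'v set \<Rightarrow> 'v set set" where
  "contract \<F> X = (\<lambda>F. F - X) ` \<F>"

lemma contractI: "F \<in> \<F> \<Longrightarrow> F - X \<in> contract \<F> X"
  by (simp add: contract_def)

lemma mem_del_verts_iff: "F \<in> del_verts \<F> X \<longleftrightarrow> F \<in> \<F> \<and> F \<inter> X = {}"
  by (simp add: del_verts_def)

lemma del_verts_subset: "del_verts \<F> X \<subseteq> \<F>"
  by (auto simp: del_verts_def)

lemma del_verts_psubset: "F \<in> \<F> \<Longrightarrow> F \<inter> X \<noteq> {} \<Longrightarrow> del_verts \<F> X \<subset> \<F>"
  by (auto simp: del_verts_def)

lemma del_verts_empty [simp]: "del_verts \<F> {} = \<F>"
  by (auto simp: del_verts_def)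

lemma del_verts_del_verts [simp]: "del_verts (del_verts \<F> X) Y = del_verts \<F> (X \<union> Y)"
  by (auto simp: del_verts_def)

lemma contract_contract [simp]: "contract (contract \<F> X) Y = contract \<F> (X \<union> Y)"
  by (simp add: contract_def image_image Diff_eq Int_assoc)

lemma contract_del_verts_subset:
  assumes "X \<subseteq> Y"
  shows "contract (del_verts \<F> Y) X = del_verts \<F> Y"
proof -
  have "F - X = F" if "F \<in> del_verts \<F> Y" for F
    using that assms by (auto simp: del_verts_def)
  then show ?thesis by (simp add: contract_def)
qed

lemma del_verts_contract: "X \<inter> Y = {} \<Longrightarrow> del_verts (contract \<F> X) Y = contract (del_verts \<F> Y) X"
  unfolding del_verts_def contract_def by blast

lemma edge_ideal_split:
  fixes \<F> :: "'v::finite set set"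
  shows "edge_ideal \<F> = edge_ideal (del_verts \<F> {x}) + edge_ideal (insert x ` contract \<F> {x})"
  unfolding edge_ideal_Un[symmetric]
proof (rule edge_ideal_eqI)
  fix F assume "F \<in> \<F>"
  show "\<exists>G\<in>del_verts \<F> {x} \<union> insert x ` contract \<F> {x}. G \<subseteq> F"
  proof (cases "x \<in> F")
    case True
    then have "F \<in> insert x ` contract \<F> {x}"
      using \<open>F \<in> \<F>\<close> by (auto simp: contract_def image_image intro!: image_eqI[of _ _ F])
    then show ?thesis by blast
  next
    case False
    then have "F \<in> del_verts \<F> {x}" using \<open>F \<in> \<F>\<close> by (simp add: del_verts_def)
    then show ?thesis by blast
  qed
qed (auto simp: del_verts_def contract_def)

lemma edge_ideal_split_Int:
  fixes \<F> :: "'v::finite set set"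
  shows "edge_ideal (del_verts \<F> {x}) \<inter> edge_ideal (insert x ` contract \<F> {x}) =
    edge_ideal (insert x ` del_verts \<F> {x})"
proof -
  have "(\<exists>F\<in>del_verts \<F> {x}. F \<subseteq> S) \<and> (\<exists>G\<in>insert x ` contract \<F> {x}. G \<subseteq> S) \<longleftrightarrow>
      (\<exists>F\<in>insert x ` del_verts \<F> {x}. F \<subseteq> S)" for S
    by (auto simp: del_verts_def contract_def)
  then show ?thesis
    by (simp add: set_eq_iff mem_edge_ideal_iff flip: ball_conj_distrib)
qed

lemma edge_regular_split:
  assumes contract: "edge_regular K (contract \<F> {x}) (r - 1)"
    and del: "edge_regular K (del_verts \<F> {x}) r"
  shows "edge_regular K \<F> r"
proof -
  have "edge_regular K (insert x ` contract \<F> {x}) r"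
    using edge_regular_insert_image[OF _ contract] by (simp add: contract_def)
  moreover have "edge_regular K (insert x ` del_verts \<F> {x}) (r + 1)"
    using edge_regular_insert_image[OF _ del] by (simp add: del_verts_def)
  ultimately show ?thesis
    using del unfolding edge_regular_def edge_ideal_split[of \<F> x]
    by (intro cm_regular_plus graded_edge_ideal) (simp_all add: edge_ideal_split_Int)
qed

lemma edge_regular_split_set:
  assumes contract: "\<And>Z y. Z \<subseteq> Y \<Longrightarrow> y \<in> Y - Z \<Longrightarrow>
      edge_regular K (contract (del_verts \<F> Z) {y}) (r - 1)"
    and del: "edge_regular K (del_verts \<F> Y) r"
  shows "edge_regular K \<F> r"
proof -
  have "edge_regular K (del_verts \<F> (Y - W)) r" if "W \<subseteq> Y" for W
    using finite[of W] that
  proof (induction W rule: finite_induct)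
    case empty
    then show ?case using del by simp
  next
    case (insert y W)
    show ?case
    proof (rule edge_regular_split)
      show "edge_regular K (contract (del_verts \<F> (Y - insert y W)) {y}) (r - 1)"
        using insert.prems by (intro contract) auto
      have "Y - insert y W \<union> {y} = Y - W"
        using insert by auto
      then show "edge_regular K (del_verts (del_verts \<F> (Y - insert y W)) {y}) r"
        using insert by simp
    qed
  qed
  from this[of Y] show ?thesis by simp
qed

lemma edge_regular_del_singletons:
  assumes "\<And>y. y \<in> Y \<Longrightarrow> {y} \<in> \<F>" "1 \<le> r" "edge_regular K (del_verts \<F> Y) r"
  shows "edge_regular K \<F> r"
proof (rule edge_regular_split_set[OF _ assms(3)])
  fix Z y assume "Z \<subseteq> Y" "y \<in> Y - Z"
  then have "{y} \<in> del_verts \<F> Z"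
    using assms(1) by (simp add: mem_del_verts_iff)
  from contractI[OF this, of "{y}"] have "{} \<in> contract (del_verts \<F> Z) {y}"
    by simp
  then show "edge_regular K (contract (del_verts \<F> Z) {y}) (r - 1)"
    using assms(2) by (intro edge_regular_UNIV) auto
qed

section \<open>Graphs and matchings\<close>

lemma simple_graph_subset: "simple_graph E \<Longrightarrow> E' \<subseteq> E \<Longrightarrow> simple_graph E'"
  unfolding simple_graph_def by blast

lemma simple_graph_del_verts: "simple_graph E \<Longrightarrow> simple_graph (del_verts E X)"
  by (rule simple_graph_subset[OF _ del_verts_subset])

lemma simple_graph_edgeE:
  assumes "simple_graph E" "e \<in> E" "x \<in> e"
  obtains y where "e = {x, y}" "y \<noteq> x"
proof -
  obtain a b where "e = {a, b}" "a \<noteq> b"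
    using assms unfolding simple_graph_def by (meson card_2_iff)
  then show ?thesis using assms(3) that[of a] that[of b] by auto
qed

lemma simple_graph_neq: "simple_graph E \<Longrightarrow> {x, y} \<in> E \<Longrightarrow> x \<noteq> y"
  unfolding simple_graph_def by force

definition nbhd :: "'v set set \<Rightarrow> 'v \<Rightarrow> 'v set" where
  "nbhd E x = {y. {x, y} \<in> E}"

lemma notin_nbhd_self: "simple_graph E \<Longrightarrow> x \<notin> nbhd E x"
  using simple_graph_neq[of E x x] unfolding nbhd_def by blast

lemma del_verts_nbhd_isolates:
  assumes "simple_graph E"
  shows "del_verts E (insert x (nbhd E x)) = del_verts E (nbhd E x)"
proof -
  have "x \<notin> e" if disjoint: "e \<in> E" "e \<inter> nbhd E x = {}" for e
  proof
    assume "x \<in> e"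
    with assms disjoint(1) obtain y where "e = {x, y}" by (rule simple_graph_edgeE)
    then show False using disjoint by (auto simp: nbhd_def)
  qed
  then show ?thesis by (auto simp: del_verts_def)
qed

lemma simple_graph_vertex_induct [consumes 1, case_names empty vertex]:
  fixes E :: "'v::finite set set"
  assumes "simple_graph E" "P {}"
    and "\<And>E x y. simple_graph E \<Longrightarrow> {x, y} \<in> E \<Longrightarrow> P (del_verts E {x}) \<Longrightarrow>
      P (del_verts E (nbhd E x)) \<Longrightarrow> P E"
  shows "P E"
  using finite[of E] assms(1)
proof (induction E rule: finite_psubset_induct)
  case (psubset E)
  show ?case
  proof (cases "E = {}")
    case False
    then obtain e x where "e \<in> E" "x \<in> e"
      using psubset.prems unfolding simple_graph_def by fastforce
    then obtain y where xy: "{x, y} \<in> E"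
      using psubset.prems by (metis simple_graph_edgeE)
    have "P (del_verts E X)" if "{x, y} \<inter> X \<noteq> {}" for X
      using that xy psubset.prems
      by (intro psubset.IH del_verts_psubset[OF xy] simple_graph_del_verts)
    then show ?thesis
      using xy by (intro assms(3)[OF psubset.prems xy]) (auto simp: nbhd_def)
  qed (use assms(2) in simp)
qed

lemma matching_card_le: "matching E M \<Longrightarrow> card M \<le> matching_number (E :: 'v::finite set set)"
  unfolding matching_number_def by (auto intro: Max_ge)

lemma maximum_matchingE:
  fixes E :: "'v::finite set set"
  obtains M where "matching E M" "card M = matching_number E"
proof -
  have "matching E {}" by (simp add: matching_def)
  then have "matching_number E \<in> card ` {M. matching E M}"
    unfolding matching_number_def by (intro Max_in) auto
  then show thesis using that by auto
qed

lemma matching_number_mono: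
  fixes E :: "'v::finite set set"
  assumes "E' \<subseteq> E"
  shows "matching_number E' \<le> matching_number E"
proof -
  obtain M where M: "matching E' M" "card M = matching_number E'"
    by (rule maximum_matchingE)
  then have "matching E M"
    using assms by (auto simp: matching_def)
  then show ?thesis using M(2) matching_card_le by metis
qed

lemma matching_number_del_verts:
  fixes E :: "'v::finite set set"
  shows "matching_number (del_verts E X) \<le> matching_number E"
  by (rule matching_number_mono[OF del_verts_subset])

lemma matching_number_del_edge:
  fixes E :: "'v::finite set set"
  assumes "e \<in> E" "e \<noteq> {}"
  shows "Suc (matching_number (del_verts E e)) \<le> matching_number E"
proof -
  obtain M where M: "matching (del_verts E e) M" "card M = matching_number (del_verts E e)"
    by (rule maximum_matchingE)
  have disjoint: "d \<inter> e = {}" if "d \<in> M" for d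
    using that M(1) by (auto simp: matching_def del_verts_def)
  have "matching E (insert e M)"
    using M(1) assms(1) disjoint by (auto simp: matching_def del_verts_def)
  moreover have "e \<notin> M"
    using disjoint assms(2) by blast
  ultimately show ?thesis
    using M(2) matching_card_le by (metis card_insert_disjoint finite)
qed

lemma matching_number_del_nbhd:
  fixes E :: "'v::finite set set"
  assumes "simple_graph E" "{x, y} \<in> E"
  shows "Suc (matching_number (del_verts E (nbhd E x))) \<le> matching_number E"
proof -
  have "del_verts E (insert x (nbhd E x)) \<subseteq> del_verts E {x, y}"
    using assms(2) by (auto simp: del_verts_def nbhd_def)
  then have "del_verts E (nbhd E x) \<subseteq> del_verts E {x, y}"
    by (simp only: del_verts_nbhd_isolates[OF assms(1)])
  from matching_number_mono[OF this] show ?thesis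
    using matching_number_del_edge[OF assms(2)] by simp
qed

section \<open>Edge ideals of graphs\<close>

lemma edge_regular_vertex:
  assumes simple: "simple_graph E" and "2 \<le> r"
    and del: "edge_regular K (del_verts E {x}) r"
    and del_nbhd: "edge_regular K (del_verts E (nbhd E x)) (r - 1)"
  shows "edge_regular K E r"
proof (rule edge_regular_split[OF _ del])
  have "x \<notin> nbhd E x"
    using simple by (rule notin_nbhd_self)
  show "edge_regular K (contract E {x}) (r - 1)"
  proof (rule edge_regular_del_singletons)
    fix y assume "y \<in> nbhd E x"
    then have "{x, y} - {x} = {y}" "{x, y} \<in> E"
      using \<open>x \<notin> nbhd E x\<close> by (auto simp: nbhd_def)
    then show "{y} \<in> contract E {x}"
      using contractI by metis
  next
    have "del_verts (contract E {x}) (nbhd E x) = del_verts E (nbhd E x)"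
      using \<open>x \<notin> nbhd E x\<close> by (simp add: del_verts_contract contract_del_verts_subset
          flip: del_verts_nbhd_isolates[OF simple])
    then show "edge_regular K (del_verts (contract E {x}) (nbhd E x)) (r - 1)"
      using del_nbhd by simp
  qed (use assms(2) in simp)
qed

lemma edge_regular_simple_graph:
  assumes "simple_graph E"
  shows "edge_regular K E (int (matching_number E) + 1)"
  using assms
proof (induction E rule: simple_graph_vertex_induct)
  case empty
  show ?case by (rule edge_regular_empty)
next
  case (vertex E x y)
  note nu_drop = matching_number_del_nbhd[OF vertex.hyps]
  show ?case
  proof (rule edge_regular_vertex[OF vertex.hyps(1)])
    show "edge_regular K (del_verts E {x}) (int (matching_number E) + 1)"
      by (rule edge_regular_mono[OF vertex.IH(1)]) (simp add: matching_number_del_verts)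
    show "edge_regular K (del_verts E (nbhd E x)) (int (matching_number E) + 1 - 1)"
      using nu_drop by (intro edge_regular_mono[OF vertex.IH(2)]) simp
  qed (use nu_drop in simp)
qed

section \<open>The second squarefree power\<close>

definition disjoint_unions :: "'v set set \<Rightarrow> 'v set set" where
  "disjoint_unions E = {e1 \<union> e2 | e1 e2. e1 \<in> E \<and> e2 \<in> E \<and> e1 \<inter> e2 = {}}"

lemma disjoint_unionsI: "e1 \<in> E \<Longrightarrow> e2 \<in> E \<Longrightarrow> e1 \<inter> e2 = {} \<Longrightarrow> e1 \<union> e2 \<in> disjoint_unions E"
  unfolding disjoint_unions_def by blast

lemma sqfree_power2_eq_edge_ideal:
  fixes E :: "'v::finite set set"
  shows "(sqfree_power2 E :: ('v, 'k::comm_ring_1) mpoly set) = edge_ideal (disjoint_unions E)"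
proof -
  have "{edge_mon e1 * edge_mon e2 | e1 e2. e1 \<in> E \<and> e2 \<in> E \<and> e1 \<inter> e2 = {}} =
      (edge_mon ` disjoint_unions E :: ('v, 'k) mpoly set)"
    unfolding disjoint_unions_def by (auto simp: edge_mon_Un intro!: image_eqI) (metis edge_mon_Un)
  then show ?thesis
    by (simp add: sqfree_power2_def edge_ideal_def)
qed

lemma del_verts_disjoint_unions: "del_verts (disjoint_unions E) X = disjoint_unions (del_verts E X)"
  unfolding del_verts_def disjoint_unions_def by blast

definition colon_graph :: "'v set set \<Rightarrow> 'v \<Rightarrow> 'v \<Rightarrow> 'v set set" where
  "colon_graph E x y =
    del_verts E {x, y} \<union> {{a, b} | a b. {x, a} \<in> E \<and> {y, b} \<in> E \<and> {x, a} \<inter> {y, b} = {}}"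

lemma simple_graph_colon_graph: "simple_graph E \<Longrightarrow> simple_graph (colon_graph E x y)"
  unfolding simple_graph_def colon_graph_def del_verts_def by auto

lemma del_verts_colon_graph:
  assumes "a \<noteq> x" "a \<noteq> y"
  shows "del_verts (colon_graph E x y) {a} = colon_graph (del_verts E {a}) x y"
  using assms unfolding colon_graph_def del_verts_def by fastforce

lemma colon_graph_edge_subset_disjoint_union:
  assumes simple: "simple_graph E" and edges: "e1 \<in> E" "e2 \<in> E" "e1 \<inter> e2 = {}"
  shows "\<exists>e\<in>colon_graph E x y. e \<subseteq> e1 \<union> e2 - {x, y}"
proof -
  have avoiding: ?thesis if "d \<in> E" "d \<subseteq> e1 \<union> e2" "d \<inter> {x, y} = {}" for d
  proof
    show "d \<in> colon_graph E x y" using that by (simp add: colon_graph_def mem_del_verts_iff)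
    show "d \<subseteq> e1 \<union> e2 - {x, y}" using that by blast
  qed
  have crossing: ?thesis if px: "p \<in> E" "x \<in> p" and qy: "q \<in> E" "y \<in> q"
    and pq: "p \<inter> q = {}" "p \<union> q = e1 \<union> e2" for p q
  proof -
    obtain a where a: "p = {x, a}" "a \<noteq> x" using simple_graph_edgeE[OF simple px] .
    obtain b where b: "q = {y, b}" "b \<noteq> y" using simple_graph_edgeE[OF simple qy] .
    show ?thesis
    proof
      show "{a, b} \<in> colon_graph E x y"
        using px(1) qy(1) pq(1) unfolding a b colon_graph_def by blast
      show "{a, b} \<subseteq> e1 \<union> e2 - {x, y}"
        using a b pq by auto
    qed
  qed
  consider "e1 \<inter> {x, y} = {}" | "e2 \<inter> {x, y} = {}" | "x \<in> e1" "y \<in> e2" | "x \<in> e2" "y \<in> e1"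
    using edges(3) by blast
  then show ?thesis
    by cases (use avoiding crossing[of e1 e2] crossing[of e2 e1] edges in blast)+
qed

lemma colon_graph_subset_contract:
  assumes simple: "simple_graph E" and edge: "{x, y} \<in> E"
  shows "colon_graph E x y \<subseteq> contract (disjoint_unions E) {x, y}"
proof
  fix e assume "e \<in> colon_graph E x y"
  then consider (avoiding) "e \<in> E" "e \<inter> {x, y} = {}"
    | (crossing) a b where "e = {a, b}" "{x, a} \<in> E" "{y, b} \<in> E" "{x, a} \<inter> {y, b} = {}"
    unfolding colon_graph_def del_verts_def by blast
  then obtain d where "d \<in> disjoint_unions E" "e = d - {x, y}"
  proof cases
    case avoiding
    then show thesis
      using that[OF disjoint_unionsI[OF _ edge]] by blast
  next
    case crossing
    then have "{x, a} \<union> {y, b} - {x, y} = {a, b}"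
      using simple_graph_neq[OF simple] by blast
    then show thesis
      using that[OF disjoint_unionsI[OF crossing(2-4)]] crossing(1) by simp
  qed
  then show "e \<in> contract (disjoint_unions E) {x, y}"
    by (simp add: contractI)
qed

lemma edge_regular_contract_disjoint_unions:
  assumes "simple_graph E" "{x, y} \<in> E"
  shows "edge_regular K (contract (disjoint_unions E) {x, y}) r \<longleftrightarrow>
    edge_regular K (colon_graph E x y) r"
proof (rule edge_regular_cong)
  fix F assume "F \<in> contract (disjoint_unions E) {x, y}"
  then obtain e1 e2 where "e1 \<in> E" "e2 \<in> E" "e1 \<inter> e2 = {}" "F = e1 \<union> e2 - {x, y}"
    unfolding contract_def disjoint_unions_def by blast
  then show "\<exists>G\<in>colon_graph E x y. G \<subseteq> F"
    using colon_graph_edge_subset_disjoint_union[OF assms(1)] by simp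
qed (use colon_graph_subset_contract[OF assms] in blast)

lemma colon_graph_del_nbhd_subset:
  assumes simple: "simple_graph E"
    and edges: "{x, a} \<in> E" "{y, b} \<in> E" and disjoint: "{x, a} \<inter> {y, b} = {}"
  shows "del_verts (colon_graph E x y) (nbhd (colon_graph E x y) a) \<subseteq>
    del_verts E ({x, a} \<union> {y, b})"
  unfolding del_verts_nbhd_isolates[OF simple_graph_colon_graph[OF simple], symmetric]
proof
  define N where "N = nbhd (colon_graph E x y) a"
  have in_N: "z \<in> N" if z: "{y, z} \<in> E" "z \<noteq> a" "z \<noteq> x" for z
  proof -
    have "{x, a} \<inter> {y, z} = {}" using disjoint z(2,3) by auto
    then show ?thesis using edges(1) z(1) unfolding N_def nbhd_def colon_graph_def by blast
  qed
  fix e assume "e \<in> del_verts (colon_graph E x y) (insert a (nbhd (colon_graph E x y) a))"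
  then have e: "e \<in> colon_graph E x y" "a \<notin> e" "e \<inter> N = {}"
    by (auto simp: mem_del_verts_iff N_def)
  have "e \<in> del_verts E {x, y}"
  proof (rule ccontr)
    assume "e \<notin> del_verts E {x, y}"
    then obtain a' b' where "e = {a', b'}" "{y, b'} \<in> E" "{x, a'} \<inter> {y, b'} = {}"
      using e(1) unfolding colon_graph_def by blast
    then show False using e(2,3) in_N[of b'] by auto
  qed
  moreover have "b \<notin> e"
    using e(3) in_N[OF edges(2)] disjoint by auto
  ultimately show "e \<in> del_verts E ({x, a} \<union> {y, b})"
    using e(2) by (auto simp: mem_del_verts_iff)
qed

lemma matching_number_colon_graph_del_nbhd:
  fixes E :: "'v::finite set set"
  assumes simple: "simple_graph E"
    and edges: "{x, a} \<in> E" "{y, b} \<in> E" and disjoint: "{x, a} \<inter> {y, b} = {}"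
  shows "matching_number (del_verts (colon_graph E x y) (nbhd (colon_graph E x y) a)) + 2 \<le>
    matching_number E"
proof -
  have "{y, b} \<in> del_verts E {x, a}"
    using edges(2) disjoint by (auto simp: del_verts_def)
  from matching_number_del_edge[OF this] matching_number_del_edge[OF edges(1)]
  have "matching_number (del_verts E ({x, a} \<union> {y, b})) + 2 \<le> matching_number E"
    by simp
  moreover note matching_number_mono[OF colon_graph_del_nbhd_subset[OF assms]]
  ultimately show ?thesis by simp
qed

lemma edge_regular_colon_graph:
  assumes "simple_graph E" "{x, y} \<in> E"
  shows "edge_regular K (colon_graph E x y) (int (matching_number E))"
  using finite[of E] assms
proof (induction E rule: finite_psubset_induct)
  case (psubset E)
  show ?case
  proof (cases "\<exists>a b. {x, a} \<in> E \<and> {y, b} \<in> E \<and> {x, a} \<inter> {y, b} = {}")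
    case False
    then have "colon_graph E x y = del_verts E {x, y}"
      unfolding colon_graph_def by blast
    then show ?thesis
      using matching_number_del_edge[OF psubset.prems(2)]
      by (auto intro!: edge_regular_mono[OF edge_regular_simple_graph] simple_graph_del_verts
          psubset.prems)
  next
    case True
    then obtain a b where ab: "{x, a} \<in> E" "{y, b} \<in> E" "{x, a} \<inter> {y, b} = {}"
      by blast
    then have a_neq: "a \<noteq> x" "a \<noteq> y"
      using simple_graph_neq[OF psubset.prems(1) ab(1)] by auto
    note nu_drop = matching_number_colon_graph_del_nbhd[OF psubset.prems(1) ab]
    show ?thesis
    proof (rule edge_regular_vertex[OF simple_graph_colon_graph[OF psubset.prems(1)]])
      have "edge_regular K (colon_graph (del_verts E {a}) x y)
          (int (matching_number (del_verts E {a})))"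
        using psubset.prems a_neq
        by (intro psubset.IH del_verts_psubset[OF ab(1)] simple_graph_del_verts)
          (auto simp: mem_del_verts_iff)
      then show "edge_regular K (del_verts (colon_graph E x y) {a}) (int (matching_number E))"
        unfolding del_verts_colon_graph[OF a_neq]
        by (rule edge_regular_mono) (simp add: matching_number_del_verts)
      show "edge_regular K (del_verts (colon_graph E x y) (nbhd (colon_graph E x y) a))
          (int (matching_number E) - 1)"
        using nu_drop
        by (intro edge_regular_mono[OF edge_regular_simple_graph] simple_graph_del_verts
            simple_graph_colon_graph psubset.prems) simp
    qed (use nu_drop in simp)
  qed
qed

lemma edge_regular_contract_vertex_disjoint_unions:
  assumes simple: "simple_graph E"
    and del_nbhd:
      "edge_regular K (disjoint_unions (del_verts E (nbhd E x))) (int (matching_number E) + 1)"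
  shows "edge_regular K (contract (disjoint_unions E) {x}) (int (matching_number E) + 1)"
proof (rule edge_regular_split_set)
  have "x \<notin> nbhd E x"
    using simple by (rule notin_nbhd_self)
  then have del: "del_verts (contract (disjoint_unions E) {x}) Z =
      contract (disjoint_unions (del_verts E Z)) {x}" if "Z \<subseteq> nbhd E x" for Z
    using that by (subst del_verts_contract) (auto simp: del_verts_disjoint_unions)
  show "edge_regular K (del_verts (contract (disjoint_unions E) {x}) (nbhd E x))
      (int (matching_number E) + 1)"
    using del_nbhd del[of "nbhd E x"]
    by (simp add: contract_del_verts_subset
        flip: del_verts_disjoint_unions del_verts_nbhd_isolates[OF simple])
  fix Z y assume Z: "Z \<subseteq> nbhd E x" and "y \<in> nbhd E x - Z"
  then have "{x, y} \<in> del_verts E Z"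
    using \<open>x \<notin> nbhd E x\<close> by (auto simp: nbhd_def mem_del_verts_iff)
  then have "edge_regular K (contract (disjoint_unions (del_verts E Z)) {x, y})
      (int (matching_number (del_verts E Z)))"
    using simple by (simp add: edge_regular_contract_disjoint_unions edge_regular_colon_graph
        simple_graph_del_verts)
  then have "edge_regular K (contract (disjoint_unions (del_verts E Z)) {x, y})
      (int (matching_number E))"
    by (rule edge_regular_mono) (simp add: matching_number_del_verts)
  then show "edge_regular K (contract (del_verts (contract (disjoint_unions E) {x}) Z) {y})
      (int (matching_number E) + 1 - 1)"
    by (simp add: del[OF Z] insert_commute[of y])
qed

lemma edge_regular_disjoint_unions:
  assumes "simple_graph E"
  shows "edge_regular K (disjoint_unions E) (int (matching_number E) + 2)"
  using assms
proof (induction E rule: simple_graph_vertex_induct)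
  case empty
  show ?case by (simp add: disjoint_unions_def edge_regular_empty)
next
  case (vertex E x y)
  show ?case
  proof (rule edge_regular_split[where x = x])
    have "edge_regular K (disjoint_unions (del_verts E (nbhd E x))) (int (matching_number E) + 1)"
      using matching_number_del_nbhd[OF vertex.hyps]
      by (intro edge_regular_mono[OF vertex.IH(2)]) simp
    from edge_regular_contract_vertex_disjoint_unions[OF vertex.hyps(1) this]
    show "edge_regular K (contract (disjoint_unions E) {x}) (int (matching_number E) + 2 - 1)"
      by (simp add: add.commute)
    show "edge_regular K (del_verts (disjoint_unions E) {x}) (int (matching_number E) + 2)"
      unfolding del_verts_disjoint_unions
      by (rule edge_regular_mono[OF vertex.IH(1)]) (simp add: matching_number_del_verts)
  qed
qed

theorem theorem2p11:
  fixes E :: "('v::{finite,linorder}) set set"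
  assumes "simple_graph E"
  shows "reg (sqfree_power2 E :: ('v, 'k::field) mpoly set) \<le> 2 + int (matching_number E)"
  unfolding sqfree_power2_eq_edge_ideal
proof (rule cm_regular_imp_reg_le[OF graded_edge_ideal])
  show "cm_regular (edge_ideal (disjoint_unions E) :: ('v, 'k) mpoly set)
      (2 + int (matching_number E))"
    using edge_regular_disjoint_unions[OF assms, of "TYPE('k)"]
    by (simp add: edge_regular_def add.commute)
qed simp

end
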